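(* Let $\mathcal{T}\subset X_Q^*$ be computably enumerable and let $g,g':\mathcal{T}\to B^*$ be two Gödel numberings. Then there effectively exists a constant $c$ (depending upon $U_2$, $g$ and $g'$) such that for all $u\in\mathcal{T}$ we have $$|\delta_g(u)-\delta_{g'}(u)|\le c.$$
   Context: $X_Q$ is an alphabet with $Q\ge 2$ elements, $X_Q^*$ is the set of finite strings over $X_Q$, and $|w|_Q$ is the length of $w\in X_Q^*$. $B=\{0,1\}$ is used in place of $X_2$. A machine on binary strings is a partial computable function $T$ from $B^*$ to $B^*$ whose domain is prefix-free. For a machine $T$ put $H_{2,T}(x)=\min\{|y|_2 : y\in B^*,\ T(y)=x\}$, with $\min\emptyset=\infty$. $U_2$ is a fixed universal machine: for every machine $T$ there is a constant $\varepsilon>0$ such that $H_{2,U_2}(x)\le H_{2,T}(x)+\varepsilon$ for all $x\in B^*$. Put $H_2=H_{2,U_2}$. A Gödel numbering is a computable, one-to-one function $g:\mathcal{T}\to B^*$. Its induced $\delta$-complexity is $\delta_g(u)=H_2(g(u))-\lceil \log_2 Q\rceil\cdot|u|_Q$ for $u\in\mathcal{T}$. *)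

theory Defs
  imports
    "HOL-Library.Nat_Bijection"
    "HOL-Library.Sublist"
    "HOL-Library.Extended_Real"
begin

section \<open>Partial recursive functions\<close>

datatype recf =
    Zero
  | Succ
  | Proj nat
  | Comp recf "recf list"
  | PrimRec recf recf
  | Mu recf

text \<open>
  \<open>eval p xs y\<close>: the program \<open>p\<close> halts on the arguments \<open>xs\<close> with value \<open>y\<close>. The recursion
  variable of \<open>PrimRec\<close> and the search variable of \<open>Mu\<close> come first in the argument list. Minimisation
  \<open>Mu f\<close> requires \<open>f\<close> to be defined and positive at all smaller values of the search variable.
\<close>

inductive eval :: "recf \<Rightarrow> nat list \<Rightarrow> nat \<Rightarrow> bool" where
  Zero: "eval Zero xs 0"
| Succ: "eval Succ [x] (Suc x)"
| Proj: "i < length xs \<Longrightarrow> eval (Proj i) xs (xs ! i)"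
| Comp: "list_all2 (\<lambda>g y. eval g xs y) gs ys \<Longrightarrow> eval f ys z \<Longrightarrow> eval (Comp f gs) xs z"
| PrimRec_0: "eval f xs y \<Longrightarrow> eval (PrimRec f g) (0 # xs) y"
| PrimRec_Suc:
    "eval (PrimRec f g) (n # xs) r \<Longrightarrow> eval g (n # r # xs) y \<Longrightarrow>
      eval (PrimRec f g) (Suc n # xs) y"
| Mu: "eval f (n # xs) 0 \<Longrightarrow> (\<forall>m<n. \<exists>k. eval f (m # xs) (Suc k)) \<Longrightarrow> eval (Mu f) xs n"

text \<open>A Goedel numbering of programs, used to let programs be inputs of programs.\<close>

primrec prog_code :: "recf \<Rightarrow> nat" where
  "prog_code Zero = prod_encode (0, 0)"
| "prog_code Succ = prod_encode (1, 0)"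
| "prog_code (Proj i) = prod_encode (2, i)"
| "prog_code (Comp f gs) =
     prod_encode (3, prod_encode (prog_code f, list_encode (map prog_code gs)))"
| "prog_code (PrimRec f g) = prod_encode (4, prod_encode (prog_code f, prog_code g))"
| "prog_code (Mu f) = prod_encode (5, prog_code f)"


section \<open>Computability on strings\<close>

text \<open>
  The alphabet with \<open>Q\<close> letters is \<open>{..<Q}\<close>. Binary strings have type \<open>bool list\<close>. Strings are handed
  to programs through the bijection \<open>list_encode\<close>.
\<close>

definition words :: "nat \<Rightarrow> nat list set" where
  "words Q = lists {..<Q}"

definition bin_encode :: "bool list \<Rightarrow> nat" where
  "bin_encode y = list_encode (map of_bool y)"

text \<open>
  \<open>p\<close> computes the partial function \<open>f\<close> with respect to encodings of inputs and outputs; it diverges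
  on (encodings of) inputs outside the domain of \<open>f\<close>.
\<close>

definition computes ::
  "('a \<Rightarrow> nat) \<Rightarrow> ('b \<Rightarrow> nat) \<Rightarrow> recf \<Rightarrow> ('a \<rightharpoonup> 'b) \<Rightarrow> bool" where
  "computes ein eout p f \<longleftrightarrow>
     (\<forall>x v. eval p [ein x] v \<longleftrightarrow> (\<exists>y. f x = Some y \<and> v = eout y))"

definition ce_set :: "nat list set \<Rightarrow> bool" where
  "ce_set A \<longleftrightarrow> (\<exists>p. \<forall>u. u \<in> A \<longleftrightarrow> (\<exists>v. eval p [list_encode u] v))"

definition computable_bound :: "(recf \<Rightarrow> recf \<Rightarrow> nat) \<Rightarrow> bool" where
  "computable_bound C \<longleftrightarrow> (\<exists>r. \<forall>p q v. eval r [prog_code p, prog_code q] v \<longleftrightarrow> v = C p q)"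


section \<open>Machines and program-size complexity\<close>

definition prefix_free :: "'a list set \<Rightarrow> bool" where
  "prefix_free D \<longleftrightarrow> (\<forall>x\<in>D. \<forall>y\<in>D. prefix x y \<longrightarrow> x = y)"

definition machine :: "(bool list \<rightharpoonup> bool list) \<Rightarrow> bool" where
  "machine T \<longleftrightarrow> (\<exists>p. computes bin_encode bin_encode p T) \<and> prefix_free (dom T)"

text \<open>The infimum in \<open>enat\<close> is attained for a nonempty set and is \<open>\<infinity>\<close> for the empty set.\<close>

definition complexity :: "(bool list \<rightharpoonup> bool list) \<Rightarrow> bool list \<Rightarrow> enat" where
  "complexity T x = (INF y \<in> {y. T y = Some x}. enat (length y))"

definition universal_machine :: "(bool list \<rightharpoonup> bool list) \<Rightarrow> bool" where
  "universal_machine U \<longleftrightarrow> machine U \<and>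
     (\<forall>T. machine T \<longrightarrow> (\<exists>\<epsilon>>0. \<forall>x. complexity U x \<le> complexity T x + enat \<epsilon>))"


section \<open>Goedel numberings and delta-complexity\<close>

text \<open>
  A function on \<open>A\<close> is rendered as a total function of which only the values on \<open>A\<close> matter. A program
  for it halts exactly on \<open>A\<close>.
\<close>

definition computes_on :: "recf \<Rightarrow> nat list set \<Rightarrow> (nat list \<Rightarrow> bool list) \<Rightarrow> bool" where
  "computes_on p A g \<longleftrightarrow> computes list_encode bin_encode p ((Some \<circ> g) |` A)"

definition goedel_numbering :: "nat list set \<Rightarrow> (nat list \<Rightarrow> bool list) \<Rightarrow> bool" where
  "goedel_numbering A g \<longleftrightarrow> (\<exists>p. computes_on p A g) \<and> inj_on g A"

definition delta ::
  "(bool list \<rightharpoonup> bool list) \<Rightarrow> nat \<Rightarrow> (nat list \<Rightarrow> bool list) \<Rightarrow> nat list \<Rightarrow> ereal" where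
  "delta U Q g u =
     ereal_of_enat (complexity U (g u)) - ereal (of_int \<lceil>log 2 (real Q)\<rceil> * real (length u))"

end

theory Submission
  imports Defs
begin

text \<open>
  One machine \<open>T\<close> serves all pairs of programs: on input \<open>0\<^sup>n1y\<close>, where \<open>n\<close> codes \<open>(p, p')\<close>, it
  computes \<open>U y\<close>, searches for an \<open>a\<close> with \<open>p a = U y\<close>, and outputs \<open>p' a\<close>. By injectivity of \<open>g\<close>
  it maps \<open>0\<^sup>n1y\<close> to \<open>g' u\<close> whenever \<open>U y = g u\<close>, so universality of \<open>U\<close> gives
  \<open>H (g' u) \<le> H (g u) + n + 1 + \<epsilon>\<close> with \<open>\<epsilon>\<close> depending on \<open>T\<close> only; this makes the bound computable
  in \<open>p\<close> and \<open>p'\<close>. The machine needs a universal program: \<open>eval\<close> is presented by a finite rule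
  system on numbers, and derivations are found by searching for a finite set of judgements that is
  closed under the rules, which is a bounded and hence decidable property.
\<close>

section \<open>Total recursive functions\<close>

text \<open>The equivalence packs existence and uniqueness of the value, which spares a determinism
  proof for \<open>eval\<close>; lists whose length is not \<open>k\<close> are left
  unconstrained.\<close>

definition total_recursive :: "nat \<Rightarrow> (nat list \<Rightarrow> nat) \<Rightarrow> bool" where
  "total_recursive k f \<longleftrightarrow> (\<exists>r. \<forall>xs v. length xs = k \<longrightarrow> (eval r xs v \<longleftrightarrow> v = f xs))"

lemma total_recursive_cong:
  assumes "total_recursive k f" and "\<And>xs. length xs = k \<Longrightarrow> f xs = g xs"
  shows "total_recursive k g"
  using assms unfolding total_recursive_def by metis

lemma total_recursive_proj:
  assumes "i < k"
  shows "total_recursive k (\<lambda>xs. xs ! i)"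
proof -
  have "eval (Proj i) xs v \<longleftrightarrow> v = xs ! i" if "length xs = k" for xs v
    using that assms by (subst eval.simps) auto
  then show ?thesis
    unfolding total_recursive_def by blast
qed

lemma eval_Comp_iff:
  "eval (Comp f gs) xs z \<longleftrightarrow> (\<exists>ys. list_all2 (\<lambda>g y. eval g xs y) gs ys \<and> eval f ys z)"
  by (subst eval.simps) auto

text \<open>Each component has exactly one value, so the intermediate list that \<open>Comp\<close>
  quantifies existentially is forced.\<close>

lemma total_recursive_comp:
  assumes f: "total_recursive (length gs) f" and gs: "\<forall>g\<in>set gs. total_recursive k g"
  shows "total_recursive k (\<lambda>xs. f (map (\<lambda>g. g xs) gs))"
proof -
  obtain r where r: "\<And>xs v. length xs = length gs \<Longrightarrow> eval r xs v \<longleftrightarrow> v = f xs"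
    using f unfolding total_recursive_def by blast
  have "\<exists>rs. \<forall>xs ys. length xs = k \<longrightarrow>
      (list_all2 (\<lambda>g y. eval g xs y) rs ys \<longleftrightarrow> ys = map (\<lambda>g. g xs) gs)"
    using gs
  proof (induction gs)
    case Nil
    then show ?case by (intro exI[of _ "[]"]) auto
  next
    case (Cons g gs)
    then obtain rs where rs: "\<And>xs ys. length xs = k \<Longrightarrow>
        list_all2 (\<lambda>g y. eval g xs y) rs ys \<longleftrightarrow> ys = map (\<lambda>g. g xs) gs"
      by auto
    obtain s where s: "\<And>xs v. length xs = k \<Longrightarrow> eval s xs v \<longleftrightarrow> v = g xs"
      using Cons.prems unfolding total_recursive_def by (meson list.set_intros(1))
    show ?case
      by (intro exI[of _ "s # rs"]) (auto simp: list_all2_Cons1 rs s)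
  qed
  then obtain rs where "\<And>xs ys. length xs = k \<Longrightarrow>
      list_all2 (\<lambda>g y. eval g xs y) rs ys \<longleftrightarrow> ys = map (\<lambda>g. g xs) gs"
    by blast
  then have "eval (Comp r rs) xs v \<longleftrightarrow> v = f (map (\<lambda>g. g xs) gs)" if "length xs = k" for xs v
    using that by (simp add: eval_Comp_iff r)
  then show ?thesis
    unfolding total_recursive_def by blast
qed

lemma map_nth_drop: "m = length xs \<Longrightarrow> map (\<lambda>i. xs ! i) [j..<m] = drop j xs"
  by (auto intro: nth_equalityI)

lemma total_recursive_drop:
  assumes "total_recursive k f" "m = j + k"
  shows "total_recursive m (\<lambda>xs. f (drop j xs))"
proof (rule total_recursive_cong)
  show "total_recursive m (\<lambda>xs. f (map (\<lambda>g. g xs) (map (\<lambda>i xs. xs ! i) [j..<m])))"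
    using assms by (intro total_recursive_comp) (auto intro: total_recursive_proj)
qed (simp add: comp_def map_nth_drop)

lemma total_recursive_Cons:
  assumes "total_recursive (Suc k) f" "total_recursive m a" "m = j + k"
  shows "total_recursive m (\<lambda>xs. f (a xs # drop j xs))"
proof (rule total_recursive_cong)
  show "total_recursive m (\<lambda>xs. f (map (\<lambda>g. g xs) (a # map (\<lambda>i xs. xs ! i) [j..<m])))"
    using assms by (intro total_recursive_comp) (auto intro: total_recursive_proj)
qed (simp add: comp_def map_nth_drop)

lemma total_recursive_Suc:
  assumes "total_recursive k a"
  shows "total_recursive k (\<lambda>xs. Suc (a xs))"
proof -
  have "eval Succ xs v \<longleftrightarrow> v = Suc (hd xs)" if "length xs = 1" for xs v
    using that by (subst eval.simps) (auto simp: length_Suc_conv)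
  then have "total_recursive (length [a]) (\<lambda>xs. Suc (hd xs))"
    unfolding total_recursive_def by auto
  from total_recursive_comp[OF this, of k] show ?thesis
    using assms by simp
qed

lemma total_recursive_const: "total_recursive k (\<lambda>_. n)"
proof (induction n)
  case 0
  have "eval Zero xs v \<longleftrightarrow> v = 0" for xs v
    by (subst eval.simps) auto
  then show ?case
    unfolding total_recursive_def by blast
qed (rule total_recursive_Suc)

text \<open>\<open>h\<close> enters through its recursion equations alone, and \<open>b\<close> is
  substituted for the recursion variable; a use only has to guess \<open>h\<close> and check two
  equations.\<close>

lemma total_recursive_rec:
  assumes b: "total_recursive k b"
    and f: "total_recursive k f" and g: "total_recursive (Suc (Suc k)) g"
    and zero: "\<And>xs. length xs = k \<Longrightarrow> h 0 xs = f xs"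
    and step: "\<And>n xs. length xs = k \<Longrightarrow> h (Suc n) xs = g (n # h n xs # xs)"
  shows "total_recursive k (\<lambda>xs. h (b xs) xs)"
proof -
  obtain r where r: "\<And>xs v. length xs = k \<Longrightarrow> eval r xs v \<longleftrightarrow> v = f xs"
    using f unfolding total_recursive_def by blast
  obtain s where s: "\<And>xs v. length xs = Suc (Suc k) \<Longrightarrow> eval s xs v \<longleftrightarrow> v = g xs"
    using g unfolding total_recursive_def by blast
  have rec: "eval (PrimRec r s) (n # xs) v \<longleftrightarrow> v = h n xs" if len: "length xs = k" for n xs v
  proof (induction n arbitrary: v)
    case 0
    show ?case
      using len by (subst eval.simps) (auto simp: r zero)
  next
    case (Suc n)
    show ?case
      using len by (subst eval.simps) (simp add: Suc s step)
  qed
  have "eval (PrimRec r s) xs v \<longleftrightarrow> v = h (hd xs) (tl xs)" if "length xs = Suc k" for xs v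
    using that rec by (cases xs) auto
  then have "total_recursive (Suc k) (\<lambda>xs. h (hd xs) (tl xs))"
    unfolding total_recursive_def by blast
  from total_recursive_Cons[OF this b, of 0] show ?thesis by simp
qed

section \<open>Closure under arithmetic, pairing and bit tests\<close>

lemma total_recursive_add:
  assumes "total_recursive k a" "total_recursive k b"
  shows "total_recursive k (\<lambda>xs. a xs + b xs)"
  by (rule total_recursive_rec[where f = a and g = "\<lambda>ys. Suc (ys ! 1)" and h = "\<lambda>n xs. a xs + n"])
    (simp_all add: assms total_recursive_Suc total_recursive_proj)

lemma total_recursive_mult:
  assumes "total_recursive k a" "total_recursive k b"
  shows "total_recursive k (\<lambda>xs. a xs * b xs)"
  by (rule total_recursive_rec[where f = "\<lambda>_. 0" and g = "\<lambda>ys. a (drop 2 ys) + ys ! 1"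
        and h = "\<lambda>n xs. a xs * n"])
    (simp_all add: assms total_recursive_add total_recursive_proj total_recursive_const
      total_recursive_drop[OF assms(1), of "Suc (Suc k)" 2])

lemma total_recursive_diff:
  assumes "total_recursive k a" "total_recursive k b"
  shows "total_recursive k (\<lambda>xs. a xs - b xs)"
proof -
  have pred: "total_recursive m (\<lambda>xs. c xs - 1)" if "total_recursive m c" for m c
    by (rule total_recursive_rec[where f = "\<lambda>_. 0" and g = "\<lambda>ys. ys ! 0" and h = "\<lambda>n _. n - 1"])
      (simp_all add: that total_recursive_proj total_recursive_const)
  show ?thesis
    by (rule total_recursive_rec[where f = a and g = "\<lambda>ys. ys ! 1 - 1" and h = "\<lambda>n xs. a xs - n"])
      (simp_all add: assms pred[simplified] total_recursive_proj)
qed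

lemma total_recursive_prod_encode:
  assumes "total_recursive k a" "total_recursive k b"
  shows "total_recursive k (\<lambda>xs. prod_encode (a xs, b xs))"
proof -
  \<comment> \<open>The Cantor pairing is a triangular number plus the first component.\<close>
  have "total_recursive k (\<lambda>xs. triangle (a xs + b xs))"
    by (rule total_recursive_rec[where f = "\<lambda>_. 0" and g = "\<lambda>ys. ys ! 1 + Suc (ys ! 0)"
          and h = "\<lambda>n _. triangle n"])
      (simp_all add: assms total_recursive_add total_recursive_Suc total_recursive_proj
        total_recursive_const)
  then show ?thesis
    unfolding prod_encode_def by (auto intro: assms total_recursive_add)
qed

lemma total_recursive_mod2:
  assumes "total_recursive k a"
  shows "total_recursive k (\<lambda>xs. a xs mod 2)"
  by (rule total_recursive_rec[where f = "\<lambda>_. 0" and g = "\<lambda>ys. 1 - ys ! 1" and h = "\<lambda>n _. n mod 2"])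
    (simp_all add: assms mod_Suc total_recursive_diff total_recursive_proj total_recursive_const)

lemma total_recursive_div2:
  assumes "total_recursive k a"
  shows "total_recursive k (\<lambda>xs. a xs div 2)"
  by (rule total_recursive_rec[where f = "\<lambda>_. 0" and g = "\<lambda>ys. ys ! 1 + ys ! 0 mod 2"
        and h = "\<lambda>n _. n div 2"])
    (simp_all add: assms total_recursive_add total_recursive_mod2 total_recursive_proj
      total_recursive_const, presburger)

text \<open>Membership of \<open>a\<close> in the set coded by \<open>b\<close> is bit
  \<open>a\<close> of \<open>b\<close>: halve \<open>a\<close> times, then take the parity.\<close>

lemma total_recursive_set_decode:
  assumes "total_recursive k a" "total_recursive k b"
  shows "total_recursive k (\<lambda>xs. of_bool (a xs \<in> set_decode (b xs)))"
proof -
  have "total_recursive k (\<lambda>xs. b xs div 2 ^ a xs)"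
    by (rule total_recursive_rec[where f = b and g = "\<lambda>ys. ys ! 1 div 2"
          and h = "\<lambda>n xs. b xs div 2 ^ n"])
      (simp_all add: assms total_recursive_div2 total_recursive_proj div_mult2_eq
        mult.commute[of 2])
  then have "total_recursive k (\<lambda>xs. (b xs div 2 ^ a xs) mod 2)"
    by (rule total_recursive_mod2)
  then show ?thesis
    by (rule total_recursive_cong) (auto simp: set_decode_def odd_iff_mod_2_eq_one)
qed


section \<open>Bounded formulas\<close>

text \<open>\<open>V i\<close> is a de Bruijn index into the environment, innermost binder first.
  The same terms serve in formulas and as patterns in rules.\<close>

datatype tm = V nat | K nat | Add tm tm | Pair tm tm

primrec tval :: "nat list \<Rightarrow> tm \<Rightarrow> nat" where
  "tval e (V i) = e ! i"
| "tval e (K n) = n"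
| "tval e (Add a b) = tval e a + tval e b"
| "tval e (Pair a b) = prod_encode (tval e a, tval e b)"

primrec closed_tm :: "nat \<Rightarrow> tm \<Rightarrow> bool" where
  "closed_tm k (V i) \<longleftrightarrow> i < k"
| "closed_tm k (K n) \<longleftrightarrow> True"
| "closed_tm k (Add a b) \<longleftrightarrow> closed_tm k a \<and> closed_tm k b"
| "closed_tm k (Pair a b) \<longleftrightarrow> closed_tm k a \<and> closed_tm k b"

lemma closed_tm_mono: "closed_tm k a \<Longrightarrow> k \<le> m \<Longrightarrow> closed_tm m a"
  by (induction a) auto

lemma tval_append: "closed_tm (length e) a \<Longrightarrow> tval (e @ e') a = tval e a"
  by (induction a) (auto simp: nth_append)

lemma total_recursive_tval: "closed_tm k a \<Longrightarrow> total_recursive k (\<lambda>e. tval e a)"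
  by (induction a)
    (auto intro: total_recursive_proj total_recursive_const total_recursive_add
      total_recursive_prod_encode)

text \<open>All quantifiers are bounded, so truth is decidable; \<open>Mem\<close> reads a number as
  a finite set, which lets numeric variables range over certificates.\<close>

datatype fm = Eq tm tm | Mem tm tm | Neg fm | Conj fm fm | BEx tm fm

primrec holds :: "nat list \<Rightarrow> fm \<Rightarrow> bool" where
  "holds e (Eq a b) \<longleftrightarrow> tval e a = tval e b"
| "holds e (Mem a b) \<longleftrightarrow> tval e a \<in> set_decode (tval e b)"
| "holds e (Neg \<phi>) \<longleftrightarrow> \<not> holds e \<phi>"
| "holds e (Conj \<phi> \<psi>) \<longleftrightarrow> holds e \<phi> \<and> holds e \<psi>"
| "holds e (BEx a \<phi>) \<longleftrightarrow> (\<exists>x<tval e a. holds (x # e) \<phi>)"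

primrec closed_fm :: "nat \<Rightarrow> fm \<Rightarrow> bool" where
  "closed_fm k (Eq a b) \<longleftrightarrow> closed_tm k a \<and> closed_tm k b"
| "closed_fm k (Mem a b) \<longleftrightarrow> closed_tm k a \<and> closed_tm k b"
| "closed_fm k (Neg \<phi>) \<longleftrightarrow> closed_fm k \<phi>"
| "closed_fm k (Conj \<phi> \<psi>) \<longleftrightarrow> closed_fm k \<phi> \<and> closed_fm k \<psi>"
| "closed_fm k (BEx a \<phi>) \<longleftrightarrow> closed_tm k a \<and> closed_fm (Suc k) \<phi>"

text \<open>Truth is represented by \<open>0\<close>, the value that \<open>Mu\<close> searches for.\<close>

lemma total_recursive_holds:
  "closed_fm k \<phi> \<Longrightarrow> total_recursive k (\<lambda>e. of_bool (\<not> holds e \<phi>))"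
proof (induction \<phi> arbitrary: k)
  case (Eq a b)
  \<comment> \<open>Subtraction is truncated: one of the two differences is positive exactly when
    the numbers differ.\<close>
  have eq: "of_bool (x \<noteq> y) = 1 - (1 - (x - y) - (y - x))" for x y :: nat
    by auto
  show ?case
    unfolding holds.simps eq using Eq
    by (intro total_recursive_diff total_recursive_tval total_recursive_const) simp_all
next
  case (Mem a b)
  have eq: "of_bool (\<not> P) = 1 - (of_bool P :: nat)" for P
    by simp
  show ?case
    unfolding holds.simps eq using Mem
    by (auto intro!: total_recursive_diff total_recursive_tval total_recursive_const
        total_recursive_set_decode)
next
  case (Neg \<phi>)
  have eq: "of_bool (\<not> P) = 1 - (of_bool P :: nat)" for P
    by simp
  show ?case
    unfolding holds.simps eq[of "\<not> _"] using Neg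
    by (auto intro!: total_recursive_diff total_recursive_const)
next
  case (Conj \<phi> \<psi>)
  have eq: "of_bool (\<not> (P \<and> R)) = 1 - (1 - (of_bool (\<not> P) :: nat)) * (1 - of_bool (\<not> R))" for P R
    by simp
  show ?case
    unfolding holds.simps eq using Conj
    by (auto intro!: total_recursive_diff total_recursive_mult total_recursive_const)
next
  case (BEx a \<phi>)
  let ?\<chi> = "\<lambda>e. of_bool (\<not> holds e \<phi>) :: nat"
  have "total_recursive k (\<lambda>e. of_bool (\<not> (\<exists>x<tval e a. holds (x # e) \<phi>)))"
  \<comment> \<open>The value at \<open>n\<close> is the product of the negated truth values at all
    \<open>x < n\<close>, so it is 1 iff no witness lies below \<open>n\<close>.\<close>
  proof (rule total_recursive_rec[where h = "\<lambda>n e. of_bool (\<not> (\<exists>x<n. holds (x # e) \<phi>))"])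
    show "total_recursive (Suc (Suc k)) (\<lambda>e. e ! 1 * ?\<chi> (e ! 0 # drop 2 e))"
      using BEx
      by (intro total_recursive_mult total_recursive_Cons[of k ?\<chi>] total_recursive_proj) auto
    show "total_recursive k (\<lambda>e. tval e a)"
      using BEx by (simp add: total_recursive_tval)
  qed (auto simp: total_recursive_const less_Suc_eq)
  then show ?case
    by simp
qed

text \<open>\<open>Mu\<close> finds the least witness. The decision program is total, so "defined
  and positive" at smaller values just means that the formula fails there.\<close>

lemma search_program:
  assumes "closed_fm (Suc k) \<phi>"
  obtains r where "\<And>xs v. length xs = k \<Longrightarrow>
    eval r xs v \<longleftrightarrow> holds (v # xs) \<phi> \<and> (\<forall>m<v. \<not> holds (m # xs) \<phi>)"
proof -
  obtain r where r: "\<And>xs v. length xs = Suc k \<Longrightarrow> eval r xs v \<longleftrightarrow> v = of_bool (\<not> holds xs \<phi>)"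
    using total_recursive_holds[OF assms] unfolding total_recursive_def by blast
  have "eval (Mu r) xs v \<longleftrightarrow> eval r (v # xs) 0 \<and> (\<forall>m<v. \<exists>j. eval r (m # xs) (Suc j))" for xs v
    by (subst eval.simps) simp
  then have "eval (Mu r) xs v \<longleftrightarrow> holds (v # xs) \<phi> \<and> (\<forall>m<v. \<not> holds (m # xs) \<phi>)"
    if "length xs = k" for xs v
    using that by (simp add: r of_bool_def) blast
  then show ?thesis
    using that by blast
qed

section \<open>Finite conjunctions and blocks of bounded quantifiers\<close>

definition conjs :: "fm list \<Rightarrow> fm" where
  "conjs \<phi>s = foldr Conj \<phi>s (Eq (K 0) (K 0))"

lemma holds_conjs [simp]: "holds e (conjs \<phi>s) \<longleftrightarrow> (\<forall>\<phi>\<in>set \<phi>s. holds e \<phi>)"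
  unfolding conjs_def by (induction \<phi>s) auto

lemma closed_conjs [simp]: "closed_fm k (conjs \<phi>s) \<longleftrightarrow> (\<forall>\<phi>\<in>set \<phi>s. closed_fm k \<phi>)"
  unfolding conjs_def by (induction \<phi>s) auto

text \<open>The bound is the variable with index \<open>i\<close> outside the block of quantifiers.\<close>

primrec bexs :: "nat \<Rightarrow> nat \<Rightarrow> fm \<Rightarrow> fm" where
  "bexs 0 i \<phi> = \<phi>"
| "bexs (Suc n) i \<phi> = BEx (V i) (bexs n (Suc i) \<phi>)"

lemma holds_bexs:
  "holds e (bexs n i \<phi>) \<longleftrightarrow>
    (\<exists>xs. length xs = n \<and> (\<forall>x\<in>set xs. x < e ! i) \<and> holds (xs @ e) \<phi>)"
proof (induction n arbitrary: e i)
  case (Suc n)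
  \<comment> \<open>The outermost quantifier pushes its witness first, so that witness ends up last
    in the block.\<close>
  have "holds e (bexs (Suc n) i \<phi>) \<longleftrightarrow> (\<exists>x ys. length ys = n \<and>
      (\<forall>x\<in>set (ys @ [x]). x < e ! i) \<and> holds ((ys @ [x]) @ e) \<phi>)"
    using Suc by auto
  also have "\<dots> \<longleftrightarrow> (\<exists>xs. length xs = Suc n \<and> (\<forall>x\<in>set xs. x < e ! i) \<and> holds (xs @ e) \<phi>)"
    unfolding length_Suc_conv_rev by blast
  finally show ?case .
qed auto

lemma closed_bexs: "closed_fm k (bexs n i \<phi>) \<longleftrightarrow> closed_fm (n + k) \<phi> \<and> (n > 0 \<longrightarrow> i < k)"
  by (induction n arbitrary: k i) auto

text \<open>Bit \<open>s\<close> of \<open>c\<close> being set forces \<open>2 ^ s \<le> c\<close>.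
  This turns quantification over the members of a coded set into a bounded one.\<close>

lemma set_decode_less:
  assumes "s \<in> set_decode c"
  shows "s < c"
proof -
  have "c div 2 ^ s \<noteq> 0"
    using assms by (auto simp: set_decode_def intro: Nat.gr0I)
  then have "2 ^ s \<le> c"
    by (simp add: div_eq_0_iff)
  then show ?thesis
    using less_exp[of s] by linarith
qed


section \<open>Finite rule systems\<close>

text \<open>
  A rule is a conclusion with a list of premises, over \<open>k\<close> variables. A certificate is a finite set in
  which every element is the conclusion of a rule instance with premises in the set. Such a set need
  not be well-founded, so soundness of a rule system has to come from a decreasing measure.
\<close>

type_synonym rule_system = "(tm \<times> tm list) list"

definition justified :: "nat \<Rightarrow> rule_system \<Rightarrow> nat \<Rightarrow> nat set \<Rightarrow> nat \<Rightarrow> bool" where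
  "justified k R b S t \<longleftrightarrow> (\<exists>(c, qs)\<in>set R. \<exists>e. length e = k \<and> (\<forall>x\<in>set e. x < b) \<and>
     t = tval e c \<and> (\<forall>q\<in>set qs. tval e q \<in> S))"

definition derivable :: "nat \<Rightarrow> rule_system \<Rightarrow> nat \<Rightarrow> bool" where
  "derivable k R t \<longleftrightarrow> (\<exists>b S. finite S \<and> t \<in> S \<and> (\<forall>s\<in>S. justified k R b S s))"

lemma justifiedI:
  assumes "(c, qs) \<in> set R" "length e = k" "\<And>x. x \<in> set e \<Longrightarrow> x < b"
    and "\<And>q. q \<in> set qs \<Longrightarrow> tval e q \<in> S"
  shows "justified k R b S (tval e c)"
  unfolding justified_def using assms by blast

lemma justifiedE:
  assumes "justified k R b S t"
  obtains c qs e where "(c, qs) \<in> set R" "length e = k" "t = tval e c" "\<And>x. x \<in> set e \<Longrightarrow> x < b"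
    and "\<And>q. q \<in> set qs \<Longrightarrow> tval e q \<in> S"
  using assms unfolding justified_def by blast

lemma justified_mono:
  assumes "justified k R b S t" "b \<le> b'" "S \<subseteq> S'"
  shows "justified k R b' S' t"
  using assms(1)
proof (rule justifiedE)
  fix c qs e
  assume "(c, qs) \<in> set R" "length e = k" "t = tval e c" "\<And>x. x \<in> set e \<Longrightarrow> x < b"
    and "\<And>q. q \<in> set qs \<Longrightarrow> tval e q \<in> S"
  then show "justified k R b' S' t"
    using assms(2,3) by (auto intro!: justifiedI dest: order_less_le_trans)
qed

text \<open>A certificate for a conclusion is also one for every premise of the instance used;
  conversely, certificates of the premises are united and the conclusion is added. Only the fixed
  point property is claimed, not leastness.\<close>

lemma derivable_iff:
  "derivable k R t \<longleftrightarrow> (\<exists>(c, qs)\<in>set R. \<exists>e. length e = k \<and> t = tval e c \<and>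
     (\<forall>q\<in>set qs. derivable k R (tval e q)))" (is "_ \<longleftrightarrow> ?rhs")
proof
  assume "derivable k R t"
  then obtain b S where S: "finite S" "t \<in> S" "\<forall>s\<in>S. justified k R b S s"
    unfolding derivable_def by blast
  then have "justified k R b S t"
    by blast
  then obtain c qs e where "(c, qs) \<in> set R" "length e = k" "t = tval e c"
    and "\<And>q. q \<in> set qs \<Longrightarrow> tval e q \<in> S"
    by (rule justifiedE) blast
  moreover have "derivable k R s" if "s \<in> S" for s
    unfolding derivable_def using S that by blast
  ultimately show ?rhs
    by blast
next
  assume ?rhs
  then obtain c qs e where rule: "(c, qs) \<in> set R" "length e = k" "t = tval e c"
    and "\<forall>q\<in>set qs. derivable k R (tval e q)"
    by blast
  then have "\<forall>q\<in>set qs. \<exists>b S. finite S \<and> tval e q \<in> S \<and> (\<forall>s\<in>S. justified k R b S s)"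
    unfolding derivable_def by simp
  then obtain B S where BS: "\<And>q. q \<in> set qs \<Longrightarrow> finite (S q) \<and> tval e q \<in> S q \<and>
      (\<forall>s\<in>S q. justified k R (B q) (S q) s)"
    by metis
  \<comment> \<open>Sums stand in for a maximum: \<open>b\<close> exceeds every rule parameter and
    every bound \<open>B q\<close>.\<close>
  define b where "b = Suc (sum_list e + sum B (set qs))"
  define S' where "S' = insert t (\<Union>q\<in>set qs. S q)"
  have "justified k R b S' s" if "q \<in> set qs" "s \<in> S q" for q s
  proof (rule justified_mono)
    show "justified k R (B q) (S q) s"
      using BS that by blast
    show "B q \<le> b"
      using member_le_sum[of q "set qs" B] that by (simp add: b_def)
    show "S q \<subseteq> S'"
      using that by (auto simp: S'_def)
  qed
  moreover have "x < b" if "x \<in> set e" for x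
    using member_le_sum_list[OF that] by (simp add: b_def)
  then have "justified k R b S' t"
    unfolding rule(3) using rule(1,2) BS by (intro justifiedI) (auto simp: S'_def)
  ultimately have "\<forall>s\<in>S'. justified k R b S' s"
    by (auto simp: S'_def)
  moreover have "finite S'" "t \<in> S'"
    using BS by (auto simp: S'_def)
  ultimately show "derivable k R t"
    unfolding derivable_def by blast
qed

text \<open>\<open>i\<close>, \<open>j\<close> and \<open>l\<close> index the parameter bound, the
  certificate and the tested element; inside the block of \<open>k\<close> parameters indices shift
  by \<open>k\<close>. The disjunction over rules is a negated conjunction of negations.\<close>

definition justified_fm :: "nat \<Rightarrow> rule_system \<Rightarrow> nat \<Rightarrow> nat \<Rightarrow> nat \<Rightarrow> fm" where
  "justified_fm k R i j l = Neg (conjs (map (\<lambda>(c, qs). Neg (bexs k i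
     (conjs (Eq (V (k + l)) c # map (\<lambda>q. Mem q (V (k + j))) qs)))) R))"

definition closed_rules :: "nat \<Rightarrow> rule_system \<Rightarrow> bool" where
  "closed_rules k R \<longleftrightarrow> (\<forall>(c, qs)\<in>set R. closed_tm k c \<and> (\<forall>q\<in>set qs. closed_tm k q))"

lemma holds_justified_fm:
  assumes "closed_rules k R"
  shows "holds e (justified_fm k R i j l) \<longleftrightarrow> justified k R (e ! i) (set_decode (e ! j)) (e ! l)"
proof -
  have nth: "length xs = k \<Longrightarrow> (xs @ e) ! (k + m) = e ! m" for xs :: "nat list" and m
    by (simp add: nth_append)
  have *: "holds e (bexs k i (conjs (Eq (V (k + l)) c # map (\<lambda>q. Mem q (V (k + j))) qs))) \<longleftrightarrow>
      (\<exists>xs. length xs = k \<and> (\<forall>x\<in>set xs. x < e ! i) \<and>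
        e ! l = tval xs c \<and> (\<forall>q\<in>set qs. tval xs q \<in> set_decode (e ! j)))"
    if "(c, qs) \<in> set R" for c qs
  proof -
    have "closed_tm k c" "\<forall>q\<in>set qs. closed_tm k q"
      using that assms unfolding closed_rules_def by auto
    then show ?thesis
      unfolding holds_bexs by (intro ex_cong1) (auto simp: nth tval_append)
  qed
  show ?thesis
    unfolding justified_fm_def justified_def using * by (auto simp: split_beta)
qed

lemma closed_justified_fm:
  assumes "closed_rules k R" "i < m" "j < m" "l < m"
  shows "closed_fm m (justified_fm k R i j l)"
  using assms unfolding closed_rules_def justified_fm_def
  by (fastforce simp: closed_bexs intro: closed_tm_mono)

section \<open>Coded judgements and the search for certificates\<close>

definition judgement :: "nat \<Rightarrow> nat \<Rightarrow> nat \<Rightarrow> nat \<Rightarrow> nat" where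
  "judgement m a b c = prod_encode (m, prod_encode (a, prod_encode (b, c)))"

definition Judgement :: "nat \<Rightarrow> tm \<Rightarrow> tm \<Rightarrow> tm \<Rightarrow> tm" where
  "Judgement m a b c = Pair (K m) (Pair a (Pair b c))"

lemma tval_Judgement [simp]:
  "tval e (Judgement m a b c) = judgement m (tval e a) (tval e b) (tval e c)"
  by (simp add: judgement_def Judgement_def)

lemma closed_Judgement [simp]:
  "closed_tm k (Judgement m a b c) \<longleftrightarrow> closed_tm k a \<and> closed_tm k b \<and> closed_tm k c"
  by (simp add: Judgement_def)

lemma judgement_eq [simp]:
  "judgement m a b c = judgement m' a' b' c' \<longleftrightarrow> m = m' \<and> a = a' \<and> b = b' \<and> c = c'"
  by (auto simp: judgement_def)

text \<open>
  The search variable codes the output \<open>w\<close>, the certificate \<open>c\<close> and a number \<open>d\<close> whose only role is to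
  make the bound on the parameters of the rule instances large enough.
\<close>

lemma uniformization_program:
  assumes R: "closed_rules k R"
  obtains r where "\<And>z w. eval r [z] w \<Longrightarrow> derivable k R (judgement m z w 0)"
    and "\<And>z w w'. eval r [z] w \<Longrightarrow> eval r [z] w' \<Longrightarrow> w = w'"
    and "\<And>z w. derivable k R (judgement m z w 0) \<Longrightarrow> \<exists>w'. eval r [z] w'"
proof -
  \<comment> \<open>Under the three quantifiers \<open>V 0\<close>, \<open>V 1\<close>,
    \<open>V 2\<close> are \<open>w\<close>, \<open>c\<close>, \<open>d\<close>, followed by the
    search value \<open>t\<close> and the input \<open>z\<close>. The last conjunct says that every
    member of \<open>c\<close> is justified with parameters below \<open>t\<close>.\<close>
  define \<phi> where "\<phi> = BEx (Add (K 1) (V 0)) (BEx (Add (K 1) (V 1)) (BEx (Add (K 1) (V 2)) (conjs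
    [Eq (V 3) (Pair (V 0) (Pair (V 1) (V 2))), Mem (Judgement m (V 4) (V 0) (K 0)) (V 1),
     Neg (BEx (V 3) (Conj (Mem (V 0) (V 2)) (Neg (justified_fm k R 4 2 0))))])))"
  have "closed_fm (Suc 1) \<phi>"
    by (simp add: \<phi>_def closed_justified_fm[OF R])
  then obtain r where r: "\<And>xs t. length xs = 1 \<Longrightarrow>
      eval r xs t \<longleftrightarrow> holds (t # xs) \<phi> \<and> (\<forall>s<t. \<not> holds (s # xs) \<phi>)"
    using search_program by blast
  have \<phi>: "holds [t, z] \<phi> \<longleftrightarrow> (\<exists>w c d. t = prod_encode (w, prod_encode (c, d)) \<and>
      judgement m z w 0 \<in> set_decode c \<and> (\<forall>s\<in>set_decode c. justified k R t (set_decode c) s))"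
    (is "_ \<longleftrightarrow> (\<exists>w c d. ?Q w c d)") for t z
  proof -
    have le: "w \<le> t \<and> c \<le> t \<and> d \<le> t" if "t = prod_encode (w, prod_encode (c, d))" for w c d
      using that le_prod_encode_1 le_prod_encode_2 order_trans by metis
    have "s < t" if "t = prod_encode (w, prod_encode (c, d))" "s \<in> set_decode c" for w c d s
      using le[OF that(1)] set_decode_less[OF that(2)] by linarith
    then have "holds [t, z] \<phi> \<longleftrightarrow> (\<exists>d<Suc t. \<exists>c<Suc t. \<exists>w<Suc t. ?Q w c d)"
      by (auto simp: \<phi>_def holds_justified_fm[OF R])
    then show ?thesis
      using le by (metis less_Suc_eq_le)
  qed
  \<comment> \<open>A second search projects the triple found to its output \<open>w\<close>.
    Several outputs may be derivable; the least triple selects one.\<close>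
  define \<psi> where "\<psi> = BEx (Add (K 1) (V 1)) (Eq (V 2) (Pair (V 1) (V 0)))"
  have "closed_fm (Suc 1) \<psi>"
    by (simp add: \<psi>_def)
  then obtain q where q: "\<And>xs w. length xs = 1 \<Longrightarrow>
      eval q xs w \<longleftrightarrow> holds (w # xs) \<psi> \<and> (\<forall>s<w. \<not> holds (s # xs) \<psi>)"
    using search_program by blast
  have \<psi>: "holds [w, prod_encode (a, b)] \<psi> \<longleftrightarrow> w = a" for w a b
    using le_prod_encode_2[of b a] by (auto simp: \<psi>_def less_Suc_eq_le)
  have q': "eval q [prod_encode (a, b)] w \<longleftrightarrow> w = a" for a b w
    by (auto simp: q \<psi>)
  have eval: "eval (Comp q [r]) [z] w \<longleftrightarrow> (\<exists>t. eval r [z] t \<and> eval q [t] w)" for z w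
    by (auto simp: eval_Comp_iff list_all2_Cons1)
  show ?thesis
  proof (rule that[of "Comp q [r]"])
    fix z w
    assume "eval (Comp q [r]) [z] w"
    then obtain t where "holds [t, z] \<phi>" and t: "eval q [t] w"
      by (auto simp: eval r)
    then obtain w' c d where "t = prod_encode (w', prod_encode (c, d))"
      and "judgement m z w' 0 \<in> set_decode c"
      and "\<forall>s\<in>set_decode c. justified k R t (set_decode c) s"
      unfolding \<phi> by blast
    moreover from this t have "w' = w"
      by (simp add: q')
    ultimately show "derivable k R (judgement m z w 0)"
      unfolding derivable_def using finite_set_decode by blast
  next
    fix z w w'
    assume "eval (Comp q [r]) [z] w" "eval (Comp q [r]) [z] w'"
    then obtain t t' where "eval r [z] t" "eval q [t] w" "eval r [z] t'" "eval q [t'] w'"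
      by (auto simp: eval)
    then show "w = w'"
      by (simp add: r q) (metis linorder_neqE_nat)
  next
    fix z w
    assume "derivable k R (judgement m z w 0)"
    then obtain b S where S: "finite S" "judgement m z w 0 \<in> S" "\<forall>s\<in>S. justified k R b S s"
      unfolding derivable_def by blast
    \<comment> \<open>Storing \<open>b\<close> in the triple gives \<open>b \<le> t\<close>, so
      parameters below \<open>b\<close> are also below \<open>t\<close>.\<close>
    define t where "t = prod_encode (w, prod_encode (set_encode S, b))"
    have "b \<le> t"
      unfolding t_def using le_prod_encode_2 order_trans by metis
    then have "holds [t, z] \<phi>"
      unfolding \<phi> using S justified_mono[of k R b S _ t S]
      by (intro exI[of _ w] exI[of _ "set_encode S"] exI[of _ b]) (auto simp: t_def)
    then have "\<exists>t. holds [t, z] \<phi> \<and> (\<forall>s<t. \<not> holds [s, z] \<phi>)"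
      using exists_least_iff[of "\<lambda>t. holds [t, z] \<phi>"] by blast
    then obtain t' where "eval r [z] t'" "holds [t', z] \<phi>"
      by (auto simp: r)
    then show "\<exists>w'. eval (Comp q [r]) [z] w'"
      unfolding eval \<phi> using q' by blast
  qed
qed


section \<open>A rule system for evaluation\<close>

text \<open>
  The judgements are, with programs and lists replaced by their codes:
  \<open>0 p xs v\<close>: \<open>eval p xs v\<close>;
  \<open>1 i xs v\<close>: \<open>xs ! i = v\<close>;
  \<open>2 gs xs ys\<close>: the programs \<open>gs\<close> have the values \<open>ys\<close> on \<open>xs\<close>;
  \<open>3 f xs n\<close>: \<open>f\<close> is defined and positive on \<open>m # xs\<close> for all \<open>m < n\<close>;
  \<open>4 n z y\<close>: \<open>z\<close> is the string \<open>0\<^sup>n1y\<close>;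
  \<open>5 w 0 0\<close>: \<open>w\<close> is a binary string;
  \<open>6 z w 0\<close>: the simulating machine may output \<open>w\<close> on \<open>z\<close>, where \<open>u\<close> is the program of the machine
  that is simulated.
\<close>

abbreviation Cons_tm :: "tm \<Rightarrow> tm \<Rightarrow> tm" where
  "Cons_tm a b \<equiv> Add (K 1) (Pair a b)"

definition eval_rules :: "nat \<Rightarrow> rule_system" where
  "eval_rules u =
    [(Judgement 0 (Pair (K 0) (K 0)) (V 0) (K 0), []),
     (Judgement 0 (Pair (K 1) (K 0)) (Cons_tm (V 0) (K 0)) (Add (K 1) (V 0)), []),
     (Judgement 0 (Pair (K 2) (V 0)) (V 1) (V 2), [Judgement 1 (V 0) (V 1) (V 2)]),
     (Judgement 0 (Pair (K 3) (Pair (V 0) (V 1))) (V 2) (V 3),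
       [Judgement 2 (V 1) (V 2) (V 4), Judgement 0 (V 0) (V 4) (V 3)]),
     (Judgement 0 (Pair (K 4) (Pair (V 0) (V 1))) (Cons_tm (K 0) (V 2)) (V 3),
       [Judgement 0 (V 0) (V 2) (V 3)]),
     (Judgement 0 (Pair (K 4) (Pair (V 0) (V 1))) (Cons_tm (Add (K 1) (V 2)) (V 3)) (V 4),
       [Judgement 0 (Pair (K 4) (Pair (V 0) (V 1))) (Cons_tm (V 2) (V 3)) (V 5),
        Judgement 0 (V 1) (Cons_tm (V 2) (Cons_tm (V 5) (V 3))) (V 4)]),
     (Judgement 0 (Pair (K 5) (V 0)) (V 1) (V 2),
       [Judgement 0 (V 0) (Cons_tm (V 2) (V 1)) (K 0), Judgement 3 (V 0) (V 1) (V 2)]),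
     (Judgement 1 (K 0) (Cons_tm (V 0) (V 1)) (V 0), []),
     (Judgement 1 (Add (K 1) (V 0)) (Cons_tm (V 1) (V 2)) (V 3), [Judgement 1 (V 0) (V 2) (V 3)]),
     (Judgement 2 (K 0) (V 0) (K 0), []),
     (Judgement 2 (Cons_tm (V 0) (V 1)) (V 2) (Cons_tm (V 3) (V 4)),
       [Judgement 0 (V 0) (V 2) (V 3), Judgement 2 (V 1) (V 2) (V 4)]),
     (Judgement 3 (V 0) (V 1) (K 0), []),
     (Judgement 3 (V 0) (V 1) (Add (K 1) (V 2)),
       [Judgement 0 (V 0) (Cons_tm (V 2) (V 1)) (Add (K 1) (V 3)), Judgement 3 (V 0) (V 1) (V 2)]),
     (Judgement 4 (K 0) (Cons_tm (K 1) (V 0)) (V 0), []),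
     (Judgement 4 (Add (K 1) (V 0)) (Cons_tm (K 0) (V 1)) (V 2), [Judgement 4 (V 0) (V 1) (V 2)]),
     (Judgement 5 (K 0) (K 0) (K 0), []),
     (Judgement 5 (Cons_tm (K 0) (V 0)) (K 0) (K 0), [Judgement 5 (V 0) (K 0) (K 0)]),
     (Judgement 5 (Cons_tm (K 1) (V 0)) (K 0) (K 0), [Judgement 5 (V 0) (K 0) (K 0)]),
     (Judgement 6 (V 0) (V 1) (K 0),
       [Judgement 4 (Pair (V 2) (V 3)) (V 0) (V 4),
        Judgement 0 (K u) (Cons_tm (V 4) (K 0)) (V 5),
        Judgement 0 (V 2) (Cons_tm (V 6) (K 0)) (V 5),
        Judgement 0 (V 3) (Cons_tm (V 6) (K 0)) (V 1),
        Judgement 5 (V 1) (K 0) (K 0)])]"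

text \<open>The rule for judgement 6 uses the most variables, \<open>V 0\<close> to
  \<open>V 6\<close>.\<close>

lemma closed_eval_rules: "closed_rules 7 (eval_rules u)"
  by (simp add: closed_rules_def eval_rules_def)

definition derives :: "nat \<Rightarrow> nat \<Rightarrow> bool" where
  "derives u t \<longleftrightarrow> derivable 7 (eval_rules u) t"

lemma ex_length_7:
  "(\<exists>e. length e = 7 \<and> P e) \<longleftrightarrow> (\<exists>x0 x1 x2 x3 x4 x5 x6. P [x0, x1, x2, x3, x4, x5, x6])"
proof -
  have *: "(\<exists>e. length e = Suc n \<and> P e) \<longleftrightarrow> (\<exists>x e. length e = n \<and> P (x # e))" for n P
    by (metis length_Cons length_Suc_conv)
  show ?thesis
    by (simp add: numeral_eq_Suc *)
qed

text \<open>One unfolding with separately quantified parameters. Simplification then discards every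
  rule whose tags do not match, by injectivity of the pairing.\<close>

lemma derives_unfold:
  "derives u t \<longleftrightarrow> (\<exists>(d, qs)\<in>set (eval_rules u). \<exists>x0 x1 x2 x3 x4 x5 x6.
     t = tval [x0, x1, x2, x3, x4, x5, x6] d \<and>
     (\<forall>q\<in>set qs. derives u (tval [x0, x1, x2, x3, x4, x5, x6] q)))"
  unfolding derives_def by (subst derivable_iff) (simp only: ex_length_7)

section \<open>Inversion of the rules, one form of judgement at a time\<close>

lemma derives_Zero: "derives u (judgement 0 (prod_encode (0, 0)) xs v) \<longleftrightarrow> v = 0"
  by (subst derives_unfold) (simp add: eval_rules_def)

lemma derives_Succ:
  "derives u (judgement 0 (prod_encode (1, 0)) xs v) \<longleftrightarrow>
    (\<exists>x. xs = Suc (prod_encode (x, 0)) \<and> v = Suc x)"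
  by (subst derives_unfold) (simp add: eval_rules_def)

lemma derives_Proj:
  "derives u (judgement 0 (prod_encode (2, i)) xs v) \<longleftrightarrow> derives u (judgement 1 i xs v)"
  by (subst derives_unfold) (simp add: eval_rules_def)

lemma derives_Comp:
  "derives u (judgement 0 (prod_encode (3, prod_encode (f, gs))) xs v) \<longleftrightarrow>
    (\<exists>ys. derives u (judgement 2 gs xs ys) \<and> derives u (judgement 0 f ys v))"
  by (subst derives_unfold) (simp add: eval_rules_def)

lemma derives_PrimRec_Nil:
  "\<not> derives u (judgement 0 (prod_encode (4, prod_encode (f, g))) 0 v)"
  by (subst derives_unfold) (simp add: eval_rules_def)

lemma derives_PrimRec_0:
  "derives u (judgement 0 (prod_encode (4, prod_encode (f, g))) (Suc (prod_encode (0, xs))) v) \<longleftrightarrow>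
    derives u (judgement 0 f xs v)"
  by (subst derives_unfold) (simp add: eval_rules_def)

lemma derives_PrimRec_Suc:
  "derives u (judgement 0 (prod_encode (4, prod_encode (f, g))) (Suc (prod_encode (Suc n, xs))) v) \<longleftrightarrow>
    (\<exists>r. derives u (judgement 0 (prod_encode (4, prod_encode (f, g)))
        (Suc (prod_encode (n, xs))) r) \<and>
      derives u (judgement 0 g (Suc (prod_encode (n, Suc (prod_encode (r, xs))))) v))"
  by (subst derives_unfold) (simp add: eval_rules_def)

lemma derives_Mu:
  "derives u (judgement 0 (prod_encode (5, f)) xs n) \<longleftrightarrow>
    derives u (judgement 0 f (Suc (prod_encode (n, xs))) 0) \<and> derives u (judgement 3 f xs n)"
  by (subst derives_unfold) (simp add: eval_rules_def)

lemma derives_nth: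
  "derives u (judgement 1 i (list_encode xs) v) \<longleftrightarrow> i < length xs \<and> v = xs ! i"
proof (induction xs arbitrary: i)
  case Nil
  show ?case
    by (subst derives_unfold) (simp add: eval_rules_def)
next
  case (Cons x xs)
  then show ?case
    by (subst derives_unfold) (cases i; auto simp: eval_rules_def)
qed

lemma derives_values_Nil: "derives u (judgement 2 0 xs ys) \<longleftrightarrow> ys = 0"
  by (subst derives_unfold) (simp add: eval_rules_def)

lemma derives_values_Cons:
  "derives u (judgement 2 (Suc (prod_encode (g, gs))) xs ys') \<longleftrightarrow>
    (\<exists>y ys. ys' = Suc (prod_encode (y, ys)) \<and>
      derives u (judgement 0 g xs y) \<and> derives u (judgement 2 gs xs ys))"
  by (subst derives_unfold) (simp add: eval_rules_def)

lemma derives_values: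
  "derives u (judgement 2 (list_encode gs) xs ys) \<longleftrightarrow>
    list_all2 (\<lambda>g y. derives u (judgement 0 g xs y)) gs (list_decode ys)"
proof -
  have "derives u (judgement 2 (list_encode gs) xs (list_encode zs)) \<longleftrightarrow>
      list_all2 (\<lambda>g y. derives u (judgement 0 g xs y)) gs zs" for zs
  proof (induction gs arbitrary: zs)
    case Nil
    show ?case
      by (cases zs) (simp_all add: derives_values_Nil)
  next
    case (Cons g gs)
    then show ?case
      by (cases zs) (simp_all add: derives_values_Cons)
  qed
  from this[of "list_decode ys"] show ?thesis
    by simp
qed

lemma derives_positive:
  "derives u (judgement 3 f xs n) \<longleftrightarrow>
    (\<forall>m<n. \<exists>k. derives u (judgement 0 f (Suc (prod_encode (m, xs))) (Suc k)))"
proof (induction n)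
  case 0
  show ?case
    by (subst derives_unfold) (simp add: eval_rules_def)
next
  case (Suc n)
  have "derives u (judgement 3 f xs (Suc n)) \<longleftrightarrow>
      (\<exists>k. derives u (judgement 0 f (Suc (prod_encode (n, xs))) (Suc k))) \<and>
      derives u (judgement 3 f xs n)"
    by (subst derives_unfold) (simp add: eval_rules_def)
  then show ?case
    by (simp only: Suc All_less_Suc)
qed

text \<open>Induction on the program supplies the decreasing measure that excludes circular
  certificates, and yields soundness and completeness together.\<close>

lemma derives_eval:
  "derives u (judgement 0 (prog_code p) (list_encode xs) v) \<longleftrightarrow> eval p xs v"
proof (induction p arbitrary: xs v)
  case Zero
  show ?case
    by (subst eval.simps) (simp add: derives_Zero)
next
  case Succ
  have "eval Succ xs v \<longleftrightarrow> (\<exists>x. list_encode xs = list_encode [x] \<and> v = Suc x)"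
    by (subst eval.simps) (auto simp only: list_encode_eq recf.distinct)
  then show ?case
    by (simp add: derives_Succ[simplified])
next
  case (Proj i)
  show ?case
    by (subst eval.simps) (auto simp: derives_Proj derives_nth[simplified])
next
  case (Comp f gs)
  \<comment> \<open>The intermediate value \<open>ys\<close> is an arbitrary number, but every
    number codes a list.\<close>
  have "derives u (judgement 2 (list_encode (map prog_code gs)) (list_encode xs) ys) \<longleftrightarrow>
      list_all2 (\<lambda>g y. eval g xs y) gs (list_decode ys)" for ys
    unfolding derives_values list_all2_conv_all_nth using Comp by auto
  moreover have "derives u (judgement 0 (prog_code f) ys v) \<longleftrightarrow> eval f (list_decode ys) v" for ys
    using Comp(1)[of "list_decode ys"] by simp
  ultimately show ?case
    by (simp add: derives_Comp eval_Comp_iff) (metis list_encode_inverse)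
next
  case (PrimRec f g)
  show ?case
  proof (cases xs)
    case Nil
    then show ?thesis
      by (subst eval.simps) (simp add: derives_PrimRec_Nil)
  next
    case (Cons n ys)
    have "derives u (judgement 0 (prog_code (PrimRec f g)) (list_encode (n # ys)) v) \<longleftrightarrow>
        eval (PrimRec f g) (n # ys) v"
    \<comment> \<open>The recursive premise concerns the same program, so here the recursion
      variable decreases.\<close>
    proof (induction n arbitrary: v)
      case 0
      show ?case
        by (subst eval.simps) (simp add: derives_PrimRec_0 PrimRec)
    next
      case (Suc n)
      have "derives u (judgement 0 (prog_code g)
            (Suc (prod_encode (n, Suc (prod_encode (r, list_encode ys))))) v) \<longleftrightarrow>
          eval g (n # r # ys) v" for r
        using PrimRec(2)[of "n # r # ys"] by simp
      then show ?case
        using Suc by (subst eval.simps) (simp add: derives_PrimRec_Suc)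
    qed
    then show ?thesis
      using Cons by blast
  qed
next
  case (Mu f)
  have "derives u (judgement 0 (prog_code f) (Suc (prod_encode (n, list_encode xs))) v) \<longleftrightarrow>
      eval f (n # xs) v" for n v
    using Mu[of "n # xs"] by simp
  then show ?case
    by (subst eval.simps) (simp add: derives_Mu derives_positive)
qed

section \<open>Headers, binary strings and runs of the simulating machine\<close>

lemma derives_header:
  "derives u (judgement 4 n (list_encode xs) y) \<longleftrightarrow> xs = replicate n 0 @ 1 # list_decode y"
proof (induction xs arbitrary: n)
  case Nil
  show ?case
    by (subst derives_unfold) (simp add: eval_rules_def)
next
  case (Cons x xs)
  show ?case
  proof (cases n)
    case 0
    then show ?thesis
      by (subst derives_unfold) (auto simp: eval_rules_def)
  next
    case (Suc n)
    then show ?thesis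
      using Cons[of n] by (subst derives_unfold) (auto simp: eval_rules_def)
  qed
qed

text \<open>Lets the simulating machine discard outputs that are not binary strings, since a header
  may name arbitrary programs.\<close>

lemma derives_binary:
  "derives u (judgement 5 w 0 0) \<longleftrightarrow> w \<in> range bin_encode"
proof -
  have "derives u (judgement 5 (list_encode ws) 0 0) \<longleftrightarrow> set ws \<subseteq> {0, 1}" for ws
  proof (induction ws)
    case Nil
    show ?case
      by (subst derives_unfold) (simp add: eval_rules_def)
  next
    case (Cons w ws)
    then show ?case
      by (subst derives_unfold) (auto simp: eval_rules_def)
  qed
  from this[of "list_decode w"]
  have "derives u (judgement 5 w 0 0) \<longleftrightarrow> (\<forall>n\<in>set (list_decode w). \<exists>b. n = of_bool b)"
    by (auto simp: ex_bool_eq)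
  also have "\<dots> \<longleftrightarrow> (\<exists>bs. list_decode w = map of_bool bs)"
    by (simp add: ex_map_conv)
  also have "\<dots> \<longleftrightarrow> (\<exists>bs. w = list_encode (map of_bool bs))"
    by (metis list_decode_inverse list_encode_inverse)
  finally show ?thesis
    by (auto simp: bin_encode_def)
qed

lemma derives_run:
  "derives u (judgement 6 z w 0) \<longleftrightarrow> (\<exists>p p' y x a.
    derives u (judgement 4 (prod_encode (p, p')) z y) \<and>
    derives u (judgement 0 u (list_encode [y]) x) \<and>
    derives u (judgement 0 p (list_encode [a]) x) \<and>
    derives u (judgement 0 p' (list_encode [a]) w) \<and>
    derives u (judgement 5 w 0 0))"
  by (subst derives_unfold) (simp add: eval_rules_def)


section \<open>Machines\<close>

lemma map_of_bool_eq: "map of_bool x = (map of_bool y :: nat list) \<longleftrightarrow> x = y"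
  by (rule inj_eq, rule inj_mapI, rule injI) (simp only: of_bool_eq_iff)

lemma bin_encode_eq [simp]: "bin_encode x = bin_encode y \<longleftrightarrow> x = y"
  by (simp add: bin_encode_def list_encode_eq map_of_bool_eq)

lemma computes_exists:
  assumes binary: "\<And>z v. eval r [bin_encode z] v \<Longrightarrow> v \<in> range bin_encode"
    and unique: "\<And>z v v'. eval r [bin_encode z] v \<Longrightarrow> eval r [bin_encode z] v' \<Longrightarrow> v = v'"
  obtains T where "computes bin_encode bin_encode r T"
proof
  let ?T = "\<lambda>z. if \<exists>y. eval r [bin_encode z] (bin_encode y)
    then Some (SOME y. eval r [bin_encode z] (bin_encode y)) else None"
  show "computes bin_encode bin_encode r ?T"
    unfolding computes_def
  proof (intro allI iffI)
    fix z v
    assume v: "eval r [bin_encode z] v"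
    then obtain y where y: "v = bin_encode y"
      using binary by blast
    then have "(SOME y. eval r [bin_encode z] (bin_encode y)) = y"
      using v unique[of z] bin_encode_eq by (intro some_equality) blast+
    then show "\<exists>y. ?T z = Some y \<and> v = bin_encode y"
      using v y by auto
  next
    fix z v
    assume "\<exists>y. ?T z = Some y \<and> v = bin_encode y"
    then show "eval r [bin_encode z] v"
      by (auto split: if_splits intro: someI)
  qed
qed

lemma complexity_le: "T y = Some x \<Longrightarrow> complexity T x \<le> enat (length y)"
  unfolding complexity_def by (auto intro: INF_lower)

text \<open>Compare \<open>U\<close> with the machine that maps only the empty string to
  \<open>x\<close>. Finiteness keeps the later subtraction of \<open>delta\<close> values
  meaningful.\<close>

lemma complexity_universal_finite:
  assumes "universal_machine U"
  shows "complexity U x \<noteq> \<infinity>"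
proof -
  \<comment> \<open>The empty string has code 0; on any other input the search never ends.\<close>
  define \<phi> where "\<phi> = Conj (Eq (V 1) (K 0)) (Eq (V 0) (K (bin_encode x)))"
  have "closed_fm (Suc 1) \<phi>"
    by (simp add: \<phi>_def)
  then obtain r where r: "\<And>xs v. length xs = 1 \<Longrightarrow>
      eval r xs v \<longleftrightarrow> holds (v # xs) \<phi> \<and> (\<forall>m<v. \<not> holds (m # xs) \<phi>)"
    using search_program by blast
  have "bin_encode z = 0 \<longleftrightarrow> z = []" for z
    using bin_encode_eq[of z "[]"] by (simp add: bin_encode_def)
  then have "computes bin_encode bin_encode r [[] \<mapsto> x]"
    unfolding computes_def by (auto simp: r \<phi>_def)
  then have "machine [[] \<mapsto> x]"
    unfolding machine_def prefix_free_def by auto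
  then obtain \<epsilon> where "complexity U x \<le> complexity [[] \<mapsto> x] x + enat \<epsilon>"
    using assms unfolding universal_machine_def by blast
  also have "\<dots> \<le> enat 0 + enat \<epsilon>"
    using complexity_le[of "[[] \<mapsto> x]" "[]" x] by (intro add_right_mono) simp
  finally show ?thesis
    by (cases "complexity U x") auto
qed

section \<open>The simulating machine\<close>

definition header :: "recf \<Rightarrow> recf \<Rightarrow> nat" where
  "header p p' = prod_encode (prog_code p, prog_code p')"

lemma replicate_True_eq:
  "replicate m False @ True # x = replicate n False @ True # y \<longleftrightarrow> m = n \<and> x = y"
proof (induction m arbitrary: n)
  case 0
  show ?case by (cases n) auto
next
  case (Suc m)
  then show ?case by (cases n) auto
qed

text \<open>Unary headers are self-delimiting, so prefix-freeness of the simulating machine reduces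
  to that of \<open>U\<close>.\<close>

lemma prefix_replicate_True:
  assumes "prefix (replicate m False @ True # x) (replicate n False @ True # y)"
  shows "m = n \<and> prefix x y"
  using assms unfolding prefix_def by (auto simp: replicate_True_eq)

lemma derives_header_bin_encode:
  "derives u (judgement 4 n (bin_encode z) y) \<longleftrightarrow>
    (\<exists>x. z = replicate n False @ True # x \<and> y = bin_encode x)"
proof
  assume "derives u (judgement 4 n (bin_encode z) y)"
  then have eq: "map of_bool z = replicate n 0 @ 1 # list_decode y"
    by (simp add: bin_encode_def derives_header)
  then obtain a b x where "z = a @ b # x" "map of_bool a = replicate n (0 :: nat)"
      "of_bool b = (1 :: nat)" and x: "map of_bool x = list_decode y"
    by (auto simp: map_eq_append_conv map_eq_Cons_conv)
  moreover from this have "a = replicate n False"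
    using map_of_bool_eq[of a "replicate n False"] by simp
  moreover have "y = bin_encode x"
    unfolding bin_encode_def x by simp
  ultimately show "\<exists>x. z = replicate n False @ True # x \<and> y = bin_encode x"
    by (auto simp: of_bool_def split: if_splits)
qed (auto simp: bin_encode_def derives_header)

lemma simulating_machine:
  assumes "machine U"
  obtains T where "machine T"
    and "\<And>A g g' p p' a y. computes_on p A g \<Longrightarrow> computes_on p' A g' \<Longrightarrow> inj_on g A \<Longrightarrow> a \<in> A \<Longrightarrow>
      U y = Some (g a) \<Longrightarrow> T (replicate (header p p') False @ True # y) = Some (g' a)"
proof -
  obtain pU where pU: "computes bin_encode bin_encode pU U" and U: "prefix_free (dom U)"
    using assms unfolding machine_def by blast
  define u where "u = prog_code pU"
  have U_iff: "derives u (judgement 0 u (list_encode [bin_encode y]) x) \<longleftrightarrow>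
      (\<exists>x'. U y = Some x' \<and> x = bin_encode x')" for x y
    using pU unfolding u_def derives_eval computes_def by blast
  obtain r where r: "\<And>z w. eval r [z] w \<Longrightarrow> derives u (judgement 6 z w 0)"
    and unique: "\<And>z w w'. eval r [z] w \<Longrightarrow> eval r [z] w' \<Longrightarrow> w = w'"
    and ex: "\<And>z w. derives u (judgement 6 z w 0) \<Longrightarrow> \<exists>w'. eval r [z] w'"
    by (rule uniformization_program[OF closed_eval_rules, of u 6, folded derives_def])
      (rule that; assumption)
  have binary: "v \<in> range bin_encode" if "eval r [bin_encode z] v" for z v
    using r[OF that] unfolding derives_run derives_binary by blast
  obtain T where T: "computes bin_encode bin_encode r T"
    by (rule computes_exists[of r]) (erule binary, erule unique, assumption, rule that)
  have T_iff: "eval r [bin_encode z] (bin_encode y) \<longleftrightarrow> T z = Some y" for z y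
    using T unfolding computes_def by simp
  \<comment> \<open>This holds for every header, meaningful or not: a halting run must first run
    \<open>U\<close> on the rest of the input.\<close>
  have shape: "\<exists>n y. z = replicate n False @ True # y \<and> y \<in> dom U" if z: "z \<in> dom T" for z
  proof -
    obtain v where "T z = Some v"
      using z by blast
    then have "derives u (judgement 6 (bin_encode z) (bin_encode v) 0)"
      using r T_iff by simp
    then obtain n y x where n: "derives u (judgement 4 n (bin_encode z) y)"
      and x: "derives u (judgement 0 u (list_encode [y]) x)"
      unfolding derives_run by (elim exE conjE) (rule that)
    obtain y' where "z = replicate n False @ True # y'" "y = bin_encode y'"
      using n unfolding derives_header_bin_encode by blast
    moreover from this obtain x' where "U y' = Some x'"
      using x U_iff by blast
    ultimately show ?thesis
      by blast
  qed
  have "prefix_free (dom T)"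
    unfolding prefix_free_def
  proof (intro ballI impI)
    fix z z'
    assume dom: "z \<in> dom T" "z' \<in> dom T" and pre: "prefix z z'"
    obtain n y where z: "z = replicate n False @ True # y" "y \<in> dom U"
      using shape[OF dom(1)] by blast
    obtain n' y' where z': "z' = replicate n' False @ True # y'" "y' \<in> dom U"
      using shape[OF dom(2)] by blast
    have "n = n' \<and> prefix y y'"
      using pre unfolding z(1) z'(1) by (rule prefix_replicate_True)
    moreover from this have "y = y'"
      using U z(2) z'(2) unfolding prefix_free_def by blast
    ultimately show "z = z'"
      unfolding z(1) z'(1) by simp
  qed
  then have "machine T"
    using T unfolding machine_def by blast
  moreover have "T (replicate (header p p') False @ True # y) = Some (g' a)"
    if p: "computes_on p A g" and p': "computes_on p' A g'" and inj: "inj_on g A" and a: "a \<in> A"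
      and y: "U y = Some (g a)" for A g g' p p' a y
  proof -
    let ?z = "replicate (header p p') False @ True # y"
    \<comment> \<open>Every number \<open>b\<close> codes a list, so a program for a function on
      \<open>A\<close> halts on \<open>b\<close> exactly when the decoded list lies in
      \<open>A\<close>.\<close>
    have eval_iff: "derives u (judgement 0 (prog_code q) (list_encode [b]) v) \<longleftrightarrow>
        list_decode b \<in> A \<and> v = bin_encode (h (list_decode b))" if "computes_on q A h" for q h b v
    proof -
      have "eval q [list_encode (list_decode b)] v \<longleftrightarrow>
          (\<exists>y. ((Some \<circ> h) |` A) (list_decode b) = Some y \<and> v = bin_encode y)"
        using that unfolding computes_on_def computes_def by blast
      then show ?thesis
        unfolding derives_eval by (auto simp: restrict_map_def)
    qed
    \<comment> \<open>On this input only one output is derivable, so the output selected by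
      \<open>r\<close> is the intended one.\<close>
    have run: "derives u (judgement 6 (bin_encode ?z) w 0) \<longleftrightarrow> w = bin_encode (g' a)" for w
    proof
      assume "derives u (judgement 6 (bin_encode ?z) w 0)"
      then obtain c c' y' x b where "derives u (judgement 4 (prod_encode (c, c')) (bin_encode ?z) y')"
        and x: "derives u (judgement 0 u (list_encode [y']) x)"
        and b: "derives u (judgement 0 c (list_encode [b]) x)"
          "derives u (judgement 0 c' (list_encode [b]) w)"
        unfolding derives_run by blast
      then have c: "c = prog_code p" "c' = prog_code p'" "y' = bin_encode y"
        by (simp_all only: derives_header_bin_encode replicate_True_eq header_def prod_encode_eq) simp_all
      have "x = bin_encode (g a)"
        using x y unfolding c U_iff by simp
      moreover have "list_decode b \<in> A" "x = bin_encode (g (list_decode b))"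
        and w: "w = bin_encode (g' (list_decode b))"
        using b unfolding c eval_iff[OF p] eval_iff[OF p'] by simp_all
      \<comment> \<open>The search may stop at any preimage of \<open>x\<close> under
        \<open>g\<close>; injectivity leaves only \<open>a\<close>.\<close>
      ultimately have "list_decode b = a"
        using inj a by (simp add: inj_on_eq_iff)
      then show "w = bin_encode (g' a)"
        using w by simp
    next
      assume w: "w = bin_encode (g' a)"
      have "derives u (judgement 4 (header p p') (bin_encode ?z) (bin_encode y))"
        by (auto simp: derives_header_bin_encode)
      moreover have "derives u (judgement 0 u (list_encode [bin_encode y]) (bin_encode (g a)))"
        unfolding U_iff using y by blast
      moreover have
        "derives u (judgement 0 (prog_code p) (list_encode [list_encode a]) (bin_encode (g a)))"
        "derives u (judgement 0 (prog_code p') (list_encode [list_encode a]) w)"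
        unfolding eval_iff[OF p] eval_iff[OF p'] using a w by simp_all
      moreover have "derives u (judgement 5 w 0 0)"
        unfolding derives_binary w by blast
      ultimately show "derives u (judgement 6 (bin_encode ?z) w 0)"
        unfolding derives_run header_def by blast
    qed
    then obtain w where "eval r [bin_encode ?z] w"
      using ex by blast
    moreover from this have "w = bin_encode (g' a)"
      using r run by blast
    ultimately have "eval r [bin_encode ?z] (bin_encode (g' a))"
      by simp
    then show ?thesis
      unfolding T_iff .
  qed
  ultimately show ?thesis
    by (rule that)
qed

text \<open>The infimum is attained at a shortest description by well-ordering of
  \<open>enat\<close>, and that description is transformed; without any description the right side
  is infinite.\<close>

lemma complexity_transfer:
  assumes "\<And>y. U y = Some x \<Longrightarrow> \<exists>z. T z = Some x' \<and> length z \<le> length y + n"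
  shows "complexity T x' \<le> complexity U x + enat n"
proof (cases "\<exists>y. U y = Some x")
  case True
  then obtain y0 where "y0 \<in> {y. U y = Some x}"
    by blast
  then have "enat (length y0) \<in> (\<lambda>y. enat (length y)) ` {y. U y = Some x}"
    by (rule imageI)
  then have "complexity U x \<in> (\<lambda>y. enat (length y)) ` {y. U y = Some x}"
    unfolding complexity_def by (rule wellorder_InfI)
  then obtain y where y: "U y = Some x" "complexity U x = enat (length y)"
    by auto
  then obtain z where "T z = Some x'" "length z \<le> length y + n"
    using assms by blast
  then show ?thesis
    using y complexity_le[of T z x'] order_trans by fastforce
next
  case False
  then show ?thesis
    by (simp add: complexity_def top_enat_def)
qed

text \<open>The length terms of the two \<open>delta\<close> values agree and cancel, both
  complexities being finite.\<close>

lemma delta_diff_le: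
  assumes "complexity U (g u) \<noteq> \<infinity>" "complexity U (g' u) \<noteq> \<infinity>"
    and "complexity U (g' u) \<le> complexity U (g u) + enat n"
    and "complexity U (g u) \<le> complexity U (g' u) + enat n"
  shows "\<bar>delta U Q g u - delta U Q g' u\<bar> \<le> ereal (real n)"
  using assms unfolding delta_def by (auto simp: abs_le_iff)

text \<open>The bound is the value of a term in the two program codes, with \<open>n\<close>
  hard-wired.\<close>

lemma computable_bound_header:
  "computable_bound (\<lambda>p q. prod_encode (header p q, header q p) + n)"
proof -
  have "total_recursive 2 (\<lambda>xs. tval xs (Add (Pair (Pair (V 0) (V 1)) (Pair (V 1) (V 0))) (K n)))"
    by (rule total_recursive_tval) simp
  then obtain r where "\<And>xs v. length xs = 2 \<Longrightarrow>
      eval r xs v \<longleftrightarrow> v = tval xs (Add (Pair (Pair (V 0) (V 1)) (Pair (V 1) (V 0))) (K n))"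
    unfolding total_recursive_def by blast
  then show ?thesis
    unfolding computable_bound_def header_def by (intro exI[of _ r]) simp
qed

theorem corollary4p5:
  fixes U :: "bool list \<Rightarrow> bool list option" and Q :: nat
  assumes "universal_machine U" and "Q \<ge> 2"
  shows "\<exists>C :: recf \<Rightarrow> recf \<Rightarrow> nat. computable_bound C \<and>
    (\<forall>A g g'. A \<subseteq> words Q \<longrightarrow> ce_set A \<longrightarrow> goedel_numbering A g \<longrightarrow> goedel_numbering A g' \<longrightarrow>
      (\<forall>p p'. computes_on p A g \<longrightarrow> computes_on p' A g' \<longrightarrow>
        (\<forall>u\<in>A. \<bar>delta U Q g u - delta U Q g' u\<bar> \<le> ereal (real (C p p')))))"
proof -
  have "machine U"
    using assms(1) unfolding universal_machine_def by blast
  then obtain T where "machine T"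
    and T: "\<And>A g g' p p' a y. computes_on p A g \<Longrightarrow> computes_on p' A g' \<Longrightarrow> inj_on g A \<Longrightarrow> a \<in> A \<Longrightarrow>
      U y = Some (g a) \<Longrightarrow> T (replicate (header p p') False @ True # y) = Some (g' a)"
    by (rule simulating_machine) (rule that; assumption)
  then obtain \<epsilon> where \<epsilon>: "\<And>x. complexity U x \<le> complexity T x + enat \<epsilon>"
    using assms(1) unfolding universal_machine_def by blast
  \<comment> \<open>A pair code dominates both components, so one \<open>C\<close> covers both
    directions. \<open>Suc\<close> pays for the separator \<open>True\<close>, and \<epsilon> for
    passing from \<open>T\<close> to \<open>U\<close>.\<close>
  define C where "C p q = prod_encode (header p q, header q p) + Suc \<epsilon>" for p q
  have transfer: "complexity U (g' a) \<le> complexity U (g a) + enat n"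
    if "computes_on p A g" "computes_on p' A g'" "inj_on g A" "a \<in> A" "header p p' + Suc \<epsilon> \<le> n"
    for p p' A g g' a n
  proof -
    have "complexity T (g' a) \<le> complexity U (g a) + enat (Suc (header p p'))"
    proof (rule complexity_transfer)
      fix y
      assume "U y = Some (g a)"
      with that(1-4) have "T (replicate (header p p') False @ True # y) = Some (g' a)"
        by (rule T)
      then show "\<exists>z. T z = Some (g' a) \<and> length z \<le> length y + Suc (header p p')"
        by (intro exI[of _ "replicate (header p p') False @ True # y"]) simp
    qed
    then have "complexity T (g' a) + enat \<epsilon> \<le> complexity U (g a) + enat (Suc (header p p')) + enat \<epsilon>"
      by (rule add_right_mono)
    also have "\<dots> \<le> complexity U (g a) + enat n"
      unfolding add.assoc using that(5) by (intro add_left_mono) simp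
    finally show ?thesis
      using \<epsilon>[of "g' a"] by (rule order_trans[rotated])
  qed
  have "\<bar>delta U Q g u - delta U Q g' u\<bar> \<le> ereal (real (C p p'))"
    if "goedel_numbering A g" "goedel_numbering A g'" "computes_on p A g" "computes_on p' A g'" "u \<in> A"
    for A g g' p p' u
  proof (rule delta_diff_le)
    have inj: "inj_on g A" "inj_on g' A"
      using that unfolding goedel_numbering_def by auto
    show "complexity U (g' u) \<le> complexity U (g u) + enat (C p p')"
      using that(3,4) inj(1) that(5) by (rule transfer) (simp add: C_def le_prod_encode_1)
    show "complexity U (g u) \<le> complexity U (g' u) + enat (C p p')"
      using that(4,3) inj(2) that(5) by (rule transfer) (simp add: C_def le_prod_encode_2)
  qed (use complexity_universal_finite[OF assms(1)] in auto)
  moreover have "computable_bound C"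
    unfolding C_def by (rule computable_bound_header)
  ultimately show ?thesis
    by (intro exI[of _ C]) blast
qed

end
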